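(* Consider an irrotational regular wave train in deep water (infinite depth) without underlying current, and let $$p(x,y)=P(x,y)-(P_{atm}-\rho g y)$$ be its dynamic pressure on the fluid domain $\overline{D_\eta}=\{(x,y): x\in\mathbb{R},\ -\infty<y\le\eta(x)\}$. Then $p$ attains its maximum value over $\overline{D_\eta}$ at the wave crest $(0,\eta(0))$ and its minimum value over $\overline{D_\eta}$ at the wave trough $(L/2,\eta(L/2))$ (up to translation by the period $L$ in $x$).
   Context: Setting: two-dimensional steady periodic irrotational gravity water waves over a homogeneous fluid of infinite depth, written in a frame moving with the wave at constant speed $c>0$, so that the flow is steady. The $x$-axis points in the direction of wave propagation and the $y$-axis vertically upwards. Constants: wave speed $c>0$, period $L>0$, density $\rho>0$, gravitational acceleration $g>0$, atmospheric pressure $P_{atm}$. The free surface is $y=\eta(x)$. The unknowns are $\eta(x)$, the velocity field $(u(x,y),v(x,y))$ and the pressure $P(x,y)$, all $L$-periodic in $x$. Governing equations: $$(u-c)u_x+vu_y=-\tfrac1\rho P_x,\qquad (u-c)v_x+vv_y=-\tfrac1\rho P_y-g,\qquad u_x+v_y=0,\qquad u_y=v_x \qquad \text{for } -\infty<y\le\eta(x),$$ $$v=(u-c)\eta_x\ \text{ on } y=\eta(x),\qquad P=P_{atm}\ \text{ on } y=\eta(x),$$ $$(u,v)\to(0,0)\ \text{ as } y\to-\infty,\ \text{ uniformly for } x\in\mathbb{R}.$$ A regular wave train is a smooth solution $(\eta,u,v,P)$ of these governing equations such that: (i) $u$ and $v$ have a single crest and trough per period; (ii) $\eta$ is strictly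 monotone between successive crests and troughs; (iii) $\eta$, $u$ and $P$ are symmetric and $v$ is antisymmetric about the crest line. The convention is that the crest is located at $x=0$ and the trough at $x=L/2$. Thus $\eta$ is strictly decreasing on $[0,L/2]$, $\eta,u,P$ are even in $x$, and $v$ is odd in $x$. "Without underlying current" means that $$k=\frac1L\int_0^L u(x,y_0)\,dx=0,$$ where $y_0$ is any fixed depth below the wave trough level. *)

theory Defs
  imports "HOL-Analysis.Analysis"
begin

definition fluid_domain :: "(real \<Rightarrow> real) \<Rightarrow> (real \<times> real) set" where
  "fluid_domain \<eta> = {(x, y). y \<le> \<eta> x}"

(* Partial derivatives up to the boundary: the derivative is taken within D, so that it is
   also meaningful at points of the free surface.  On the region below the graph of a
   differentiable function such derivatives are unique. *)

definition partial_x :: "(real \<times> real) set \<Rightarrow> (real \<times> real \<Rightarrow> real) \<Rightarrow> real \<times> real \<Rightarrow> real" where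
  "partial_x D f z = frechet_derivative f (at z within D) (1, 0)"

definition partial_y :: "(real \<times> real) set \<Rightarrow> (real \<times> real \<Rightarrow> real) \<Rightarrow> real \<times> real \<Rightarrow> real" where
  "partial_y D f z = frechet_derivative f (at z within D) (0, 1)"

primrec Ck_on :: "nat \<Rightarrow> (real \<times> real) set \<Rightarrow> (real \<times> real \<Rightarrow> real) \<Rightarrow> bool" where
  "Ck_on 0 D f \<longleftrightarrow> continuous_on D f"
| "Ck_on (Suc k) D f \<longleftrightarrow>
     f differentiable_on D \<and> Ck_on k D (partial_x D f) \<and> Ck_on k D (partial_y D f)"

definition smooth_on :: "(real \<times> real) set \<Rightarrow> (real \<times> real \<Rightarrow> real) \<Rightarrow> bool" where
  "smooth_on D f \<longleftrightarrow> (\<forall>k. Ck_on k D f)"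

definition smooth_profile :: "(real \<Rightarrow> real) \<Rightarrow> bool" where
  "smooth_profile \<eta> \<longleftrightarrow> (\<forall>k. (deriv ^^ k) \<eta> differentiable_on UNIV)"

definition x_periodic :: "real \<Rightarrow> (real \<times> real) set \<Rightarrow> (real \<times> real \<Rightarrow> real) \<Rightarrow> bool" where
  "x_periodic L D f \<longleftrightarrow> (\<forall>(x, y)\<in>D. f (x + L, y) = f (x, y))"

(* The values of u, v, P above the free surface are irrelevant.  This includes the decay
   condition: a periodic continuous profile is bounded below, so for y near -infinity the
   whole horizontal line at height y lies in the fluid. *)

definition water_wave ::
  "real \<Rightarrow> real \<Rightarrow> real \<Rightarrow> real \<Rightarrow> real \<Rightarrow> (real \<Rightarrow> real) \<Rightarrow> (real \<times> real \<Rightarrow> real) \<Rightarrow>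
   (real \<times> real \<Rightarrow> real) \<Rightarrow> (real \<times> real \<Rightarrow> real) \<Rightarrow> bool" where
  "water_wave c L \<rho> g Patm \<eta> u v P \<longleftrightarrow>
     (let D = fluid_domain \<eta>; dx = partial_x D; dy = partial_y D in
       (\<forall>x. \<eta> (x + L) = \<eta> x) \<and> x_periodic L D u \<and> x_periodic L D v \<and> x_periodic L D P \<and>
       (\<forall>z\<in>D. (u z - c) * dx u z + v z * dy u z = - (1 / \<rho>) * dx P z) \<and>
       (\<forall>z\<in>D. (u z - c) * dx v z + v z * dy v z = - (1 / \<rho>) * dy P z - g) \<and>
       (\<forall>z\<in>D. dx u z + dy v z = 0) \<and>
       (\<forall>z\<in>D. dy u z = dx v z) \<and>
       (\<forall>x. v (x, \<eta> x) = (u (x, \<eta> x) - c) * deriv \<eta> x) \<and>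
       (\<forall>x. P (x, \<eta> x) = Patm) \<and>
       uniform_limit UNIV (\<lambda>y x. (u (x, y), v (x, y))) (\<lambda>x. (0, 0)) at_bot)"

(* Crests and troughs of a function on D are its local maxima and minima relative to D, which
   may lie on the boundary of D. *)

definition crest_on :: "(real \<times> real) set \<Rightarrow> (real \<times> real \<Rightarrow> real) \<Rightarrow> real \<times> real \<Rightarrow> bool" where
  "crest_on D f z \<longleftrightarrow> z \<in> D \<and> (\<forall>\<^sub>F w in at z within D. f w \<le> f z)"

definition trough_on :: "(real \<times> real) set \<Rightarrow> (real \<times> real \<Rightarrow> real) \<Rightarrow> real \<times> real \<Rightarrow> bool" where
  "trough_on D f z \<longleftrightarrow> z \<in> D \<and> (\<forall>\<^sub>F w in at z within D. f z \<le> f w)"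

definition single_crest_and_trough ::
  "real \<Rightarrow> (real \<times> real) set \<Rightarrow> (real \<times> real \<Rightarrow> real) \<Rightarrow> bool" where
  "single_crest_and_trough L D f \<longleftrightarrow>
     (\<exists>!z. fst z \<in> {0..<L} \<and> crest_on D f z) \<and> (\<exists>!z. fst z \<in> {0..<L} \<and> trough_on D f z)"

definition regular_wave_train ::
  "real \<Rightarrow> real \<Rightarrow> real \<Rightarrow> real \<Rightarrow> real \<Rightarrow> (real \<Rightarrow> real) \<Rightarrow> (real \<times> real \<Rightarrow> real) \<Rightarrow>
   (real \<times> real \<Rightarrow> real) \<Rightarrow> (real \<times> real \<Rightarrow> real) \<Rightarrow> bool" where
  "regular_wave_train c L \<rho> g Patm \<eta> u v P \<longleftrightarrow>
     (let D = fluid_domain \<eta> in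
       smooth_profile \<eta> \<and> smooth_on D u \<and> smooth_on D v \<and> smooth_on D P \<and>
       water_wave c L \<rho> g Patm \<eta> u v P \<and>
       single_crest_and_trough L D u \<and> single_crest_and_trough L D v \<and>
       monotone_on {0..L/2} (<) (>) \<eta> \<and>
       (\<forall>x. \<eta> (- x) = \<eta> x) \<and>
       (\<forall>(x, y)\<in>D. u (- x, y) = u (x, y) \<and> P (- x, y) = P (x, y) \<and> v (- x, y) = - v (x, y)))"

definition mean_current :: "real \<Rightarrow> (real \<times> real \<Rightarrow> real) \<Rightarrow> real \<Rightarrow> real" where
  "mean_current L u y0 = (1 / L) * integral {0..L} (\<lambda>x. u (x, y0))"

definition without_current :: "real \<Rightarrow> (real \<Rightarrow> real) \<Rightarrow> (real \<times> real \<Rightarrow> real) \<Rightarrow> bool" where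
  "without_current L \<eta> u \<longleftrightarrow> (\<forall>y0 < \<eta> (L/2). mean_current L u y0 = 0)"

definition dynamic_pressure ::
  "real \<Rightarrow> real \<Rightarrow> real \<Rightarrow> (real \<times> real \<Rightarrow> real) \<Rightarrow> real \<times> real \<Rightarrow> real" where
  "dynamic_pressure \<rho> g Patm P = (\<lambda>(x, y). P (x, y) - (Patm - \<rho> * g * y))"

end

theory Submission
  imports Defs "HOL-Complex_Analysis.Complex_Analysis"
begin

text \<open>
  Write \<open>W = u - c - \<i> v\<close>, a holomorphic function of \<open>z = x + \<i> y\<close>.  Bernoulli's law turns the
  dynamic pressure into a constant minus \<open>\<rho> \<bar>W\<bar>\<^sup>2 / 2\<close>, and on the free surface it equals
  \<open>\<rho> g \<eta>\<close>, so on the surface \<open>\<bar>W\<bar>\<close> is smallest at the crests and largest at the troughs.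
  The map \<open>z \<mapsto> exp (- 2 \<pi> \<i> z / L)\<close> makes the fluid, together with the point at infinite
  depth, where \<open>W = - c\<close>, into a bounded domain that is starlike about the origin.  There the
  maximum modulus principle applies to \<open>W\<close>, and also to \<open>1 / W\<close> once \<open>W\<close> has no zeros.

  Zeros are excluded as follows: by Bernoulli's law the surface can stagnate only at a crest, so
  \<open>u - c\<close> has one sign on the surface; it is the negative one because the value at infinite depth
  is \<open>- c\<close>, hence \<open>u < c\<close> inside.  If the crest itself is a stagnation point, it is trivially
  the unique minimum of \<open>\<bar>W\<bar>\<close> up to periods.
\<close>

section \<open>The maximum principle for periodic functions below a graph\<close>

definition lower_region :: "(real \<Rightarrow> real) \<Rightarrow> complex set" where
  "lower_region \<eta> = {z. Im z \<le> \<eta> (Re z)}"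

definition open_lower_region :: "(real \<Rightarrow> real) \<Rightarrow> complex set" where
  "open_lower_region \<eta> = {z. Im z < \<eta> (Re z)}"

lemma open_lower_region_subset: "open_lower_region \<eta> \<subseteq> lower_region \<eta>"
  by (auto simp: lower_region_def open_lower_region_def)

text \<open>Each surface point is the limit of the points straight below it. This later carries
  constancy of a function from the interior up to the surface.\<close>

lemma closure_open_lower_region:
  assumes "continuous_on UNIV \<eta>"
  shows "closure (open_lower_region \<eta>) = lower_region \<eta>"
proof
  have "closed (lower_region \<eta>)"
    unfolding lower_region_def
    by (intro closed_Collect_le continuous_intros continuous_on_compose2[OF assms]) auto
  then show "closure (open_lower_region \<eta>) \<subseteq> lower_region \<eta>"
    by (simp add: closure_minimal open_lower_region_subset)
  show "lower_region \<eta> \<subseteq> closure (open_lower_region \<eta>)"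
  proof
    fix z assume z: "z \<in> lower_region \<eta>"
    show "z \<in> closure (open_lower_region \<eta>)"
      unfolding closure_approachable
    proof (intro allI impI)
      fix e :: real assume e: "e > 0"
      show "\<exists>y\<in>open_lower_region \<eta>. dist y z < e"
      proof
        show "z - \<i> * of_real (e/2) \<in> open_lower_region \<eta>"
          using z e by (auto simp: lower_region_def open_lower_region_def)
        show "dist (z - \<i> * of_real (e/2)) z < e"
          using e by (simp add: dist_norm norm_mult)
      qed
    qed
  qed
qed

lemma open_open_lower_region:
  assumes "continuous_on UNIV \<eta>"
  shows "open (open_lower_region \<eta>)"
  unfolding open_lower_region_def
  by (intro open_Collect_less continuous_intros continuous_on_compose2[OF assms]) auto

text \<open>Invariance of \<open>S\<close> is an equivalence so that the induction can also descend
  to negative multiples.\<close>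

lemma periodic_on_of_int:
  fixes f :: "'a::comm_ring_1 \<Rightarrow> 'b"
  assumes "\<And>z. z + a \<in> S \<longleftrightarrow> z \<in> S" and "\<And>z. z \<in> S \<Longrightarrow> f (z + a) = f z"
    and "z \<in> S"
  shows "z + of_int n * a \<in> S \<and> f (z + of_int n * a) = f z"
proof (induction n rule: int_induct[where k = 0])
  case base
  then show ?case using assms by simp
next
  case (step1 i)
  then show ?case
    using assms(1,2)[of "z + of_int i * a"] by (simp add: algebra_simps)
next
  case (step2 i)
  have "z + of_int (i - 1) * a + a = z + of_int i * a"
    by (simp add: algebra_simps)
  with step2 assms(1,2)[of "z + of_int (i - 1) * a"] show ?case
    by metis
qed

lemma periodic_of_int:
  fixes f :: "'a::comm_ring_1 \<Rightarrow> 'b"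
  assumes "\<And>z. f (z + a) = f z"
  shows "f (z + of_int n * a) = f z"
  using periodic_on_of_int[of a UNIV f z n] assms by simp

text \<open>The inverse of the covering map \<open>z \<mapsto> exp (- 2 \<pi> \<i> z / L)\<close>, which sends
  \<open>Im z \<rightarrow> -\<infinity>\<close> to the origin.  It is discontinuous across the cut of \<open>Ln\<close>,
  but only by multiples of \<open>L\<close>.\<close>

definition period_log :: "real \<Rightarrow> complex \<Rightarrow> complex" where
  "period_log L q = \<i> * of_real (L / (2 * pi)) * Ln q"

lemma Re_period_log: "Re (period_log L q) = - (L / (2 * pi)) * Im (Ln q)"
  and Im_period_log: "q \<noteq> 0 \<Longrightarrow> Im (period_log L q) = L / (2 * pi) * ln (norm q)"
  by (simp_all add: period_log_def)

text \<open>Two logarithms of \<open>q\<close> differ by a multiple of 2 pi i, which the factor in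
  \<open>period_log\<close> turns into a real multiple of \<open>L\<close>.\<close>

lemma exp_eq_period_log:
  assumes "exp w = q"
  obtains n :: int where "period_log L q = \<i> * of_real (L / (2 * pi)) * w + of_int n * of_real L"
proof -
  have "q \<noteq> 0" using assms by auto
  then have "exp (Ln q) = exp w" using assms by simp
  then obtain n :: int where "Ln q = w + (of_int (2 * n) * pi) * \<i>"
    by (auto simp: exp_eq)
  then have "period_log L q = \<i> * of_real (L / (2 * pi)) * w + of_int (-n) * of_real L"
    by (simp add: period_log_def field_simps)
  then show ?thesis by (rule that)
qed

lemma period_log_surj:
  assumes "L > 0"
  obtains q n where "q \<noteq> 0" "period_log L q = z + of_int n * of_real L"
proof -
  \<comment> \<open>The exponent of the covering map, so that \<open>exp w\<close> is the image of
    \<open>z\<close>.\<close>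
  define w where "w = - \<i> * of_real (2 * pi / L) * z"
  obtain n where "period_log L (exp w) = \<i> * of_real (L / (2 * pi)) * w + of_int n * of_real L"
    using exp_eq_period_log[of w "exp w"] by blast
  moreover have "\<i> * of_real (L / (2 * pi)) * w = z"
    using assms by (simp add: w_def field_simps)
  ultimately show ?thesis
    using that[of "exp w" n] by simp
qed

text \<open>A branch of the logarithm that is continuous near \<open>p\<close>, wherever \<open>p\<close> lies.\<close>

definition local_log :: "real \<Rightarrow> complex \<Rightarrow> complex \<Rightarrow> complex" where
  "local_log L p q = \<i> * of_real (L / (2 * pi)) * (Ln p + Ln (q / p))"

text \<open>A ratio \<open>q / p\<close> on the cut would be some \<open>r\<close> \<le> 0, whence
  |p - q| = (1 - r) |p| \<ge> |p|, which is impossible inside the ball.\<close>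

lemma holomorphic_local_log: "p \<noteq> 0 \<Longrightarrow> local_log L p holomorphic_on ball p (norm p)"
proof -
  assume p: "p \<noteq> 0"
  have "q / p \<notin> \<real>\<^sub>\<le>\<^sub>0" if "q \<in> ball p (norm p)" for q
  proof
    assume "q / p \<in> \<real>\<^sub>\<le>\<^sub>0"
    then obtain r where r: "q / p = of_real r" "r \<le> 0"
      by (auto elim!: nonpos_Reals_cases)
    then have "p - q = of_real (1 - r) * p" using p by (simp add: field_simps)
    then have "norm (p - q) = (1 - r) * norm p" using r by (simp add: norm_mult del: of_real_diff)
    moreover have "1 * norm p \<le> (1 - r) * norm p" using r by (intro mult_right_mono) auto
    ultimately show False using that by (simp add: dist_norm)
  qed
  then show ?thesis
    unfolding local_log_def using p by (intro holomorphic_intros) auto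
qed

lemma period_log_local_log:
  assumes "p \<noteq> 0" "q \<noteq> 0"
  obtains n where "period_log L q = local_log L p q + of_int n * of_real L"
proof -
  have "exp (Ln p + Ln (q / p)) = q" using assms by (simp add: exp_add)
  then show ?thesis
    using exp_eq_period_log[of "Ln p + Ln (q / p)" q] that unfolding local_log_def by blast
qed

section \<open>Periodic functions composed with the discontinuous logarithm\<close>

context
  fixes S :: "complex set" and f :: "complex \<Rightarrow> 'a::topological_space" and L :: real
  assumes S: "\<And>z. z + of_real L \<in> S \<longleftrightarrow> z \<in> S"
    and f: "\<And>z. z \<in> S \<Longrightarrow> f (z + of_real L) = f z"
begin

text \<open>A periodic function cannot distinguish the global logarithm from the local branch, so
  the jump across the cut becomes invisible.\<close>

lemma period_log_eq_local_log:
  assumes "p \<noteq> 0" "q \<noteq> 0" "period_log L q \<in> S"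
  shows "local_log L p q \<in> S" "f (period_log L q) = f (local_log L p q)"
proof -
  obtain n where n: "period_log L q = local_log L p q + of_int n * of_real L"
    using period_log_local_log assms by blast
  then have *: "local_log L p q = period_log L q + of_int (-n) * of_real L" by simp
  then show "local_log L p q \<in> S" "f (period_log L q) = f (local_log L p q)"
    using periodic_on_of_int[where f = f and S = S, OF S f assms(3)] by metis+
qed

lemma continuous_on_period_log:
  assumes "continuous_on S f"
  shows "continuous_on {q. q \<noteq> 0 \<and> period_log L q \<in> S} (\<lambda>q. f (period_log L q))"
  unfolding continuous_on_eq_continuous_within
proof
  let ?A = "{q. q \<noteq> 0 \<and> period_log L q \<in> S}"
  fix p assume p: "p \<in> ?A"
  have "continuous_on (?A \<inter> ball p (norm p)) (\<lambda>q. f (local_log L p q))"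
    using p holomorphic_local_log[of p L, THEN holomorphic_on_imp_continuous_on]
    by (intro continuous_on_compose2[OF assms])
       (auto intro: continuous_on_subset period_log_eq_local_log)
  then have "continuous (at p within ?A \<inter> ball p (norm p)) (\<lambda>q. f (local_log L p q))"
    using p by (auto simp: continuous_on_eq_continuous_within)
  then have "continuous (at p within ?A) (\<lambda>q. f (local_log L p q))"
    using p at_within_nhd[of p "ball p (norm p)" "?A \<inter> ball p (norm p)" ?A] by auto
  \<comment> \<open>Both functions agree on all of \<open>?A\<close>, so the radius 1 is
    arbitrary.\<close>
  then show "continuous (at p within ?A) (\<lambda>q. f (period_log L q))"
    by (rule continuous_transform_within[where \<delta> = 1])
       (use p period_log_eq_local_log(2)[of p] in auto)
qed

end

lemma holomorphic_on_period_log: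
  assumes S: "\<And>z. z + of_real L \<in> S \<longleftrightarrow> z \<in> S"
    and f: "\<And>z. z \<in> S \<Longrightarrow> f (z + of_real L) = f z"
    and holf: "f holomorphic_on S" and "open S"
    and op: "open {q. q \<noteq> 0 \<and> period_log L q \<in> S}" (is "open ?A")
  shows "(\<lambda>q. f (period_log L q)) holomorphic_on {q. q \<noteq> 0 \<and> period_log L q \<in> S}"
  unfolding holomorphic_on_def
proof
  fix p assume p: "p \<in> ?A"
  let ?B = "?A \<inter> ball p (norm p)"
  have "(\<lambda>q. f (local_log L p q)) holomorphic_on ?B"
    using p holomorphic_local_log[of p L] period_log_eq_local_log[where f = f and S = S, OF S f]
    by (intro holomorphic_on_compose_gen[OF _ holf, unfolded o_def])
       (auto intro: holomorphic_on_subset)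
  then have "(\<lambda>q. f (period_log L q)) holomorphic_on ?B"
    by (rule holomorphic_transform)
       (use p period_log_eq_local_log(2)[where f = f and S = S and p = p, OF S f] in auto)
  moreover have "open ?B" "p \<in> ?B" using op p by auto
  ultimately have "(\<lambda>q. f (period_log L q)) field_differentiable at p"
    using holomorphic_on_imp_differentiable_at by blast
  then show "(\<lambda>q. f (period_log L q)) field_differentiable at p within ?A"
    by (rule field_differentiable_at_within)
qed

section \<open>The fluid completed at infinite depth to a bounded domain\<close>

locale periodic_profile =
  fixes L :: real and \<eta> :: "real \<Rightarrow> real"
  assumes L_pos: "L > 0" and cont: "continuous_on UNIV \<eta>" and per: "\<And>x. \<eta> (x + L) = \<eta> x"
begin

text \<open>The ratio \<open>x / L\<close> is within 1/2 of its nearest integer. The interval is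
  symmetric so that evenness of the profile can be used on it later.\<close>

lemma shift_into_centered_period:
  obtains n :: int where "- (L / 2) \<le> x + of_int n * L" "x + of_int n * L \<le> L / 2"
proof
  have "of_int (round (x / L)) - 1/2 \<le> x / L" "x / L \<le> of_int (round (x / L)) + 1/2"
    using of_int_round_abs_le[of "x / L"] by linarith+
  then show "- (L / 2) \<le> x + of_int (- round (x / L)) * L" "x + of_int (- round (x / L)) * L \<le> L / 2"
    using L_pos by (simp_all add: field_simps)
qed

lemma profile_bounds:
  obtains m M where "\<And>x. m \<le> \<eta> x" "\<And>x. \<eta> x \<le> M"
proof -
  have "compact (\<eta> ` {-L/2..L/2})"
    by (intro compact_continuous_image continuous_on_subset[OF cont]) auto
  then have "bounded (\<eta> ` {-L/2..L/2})" by (rule compact_imp_bounded)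
  then obtain B where B: "\<And>x. x \<in> {-L/2..L/2} \<Longrightarrow> \<bar>\<eta> x\<bar> \<le> B"
    unfolding bounded_iff by (metis imageI real_norm_def)
  have "\<bar>\<eta> x\<bar> \<le> B" for x
  proof -
    obtain n :: int where "- (L / 2) \<le> x + of_int n * L" "x + of_int n * L \<le> L / 2"
      by (rule shift_into_centered_period)
    then have "\<bar>\<eta> (x + of_int n * L)\<bar> \<le> B" by (intro B) auto
    then show ?thesis using periodic_of_int[of \<eta> L x n, OF per] by simp
  qed
  then show ?thesis using that[of "-B" B] by (meson abs_le_iff minus_le_iff)
qed

lemma lower_region_shift: "z + of_real L \<in> lower_region \<eta> \<longleftrightarrow> z \<in> lower_region \<eta>"
  and open_lower_region_shift: "z + of_real L \<in> open_lower_region \<eta> \<longleftrightarrow> z \<in> open_lower_region \<eta>"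
  by (simp_all add: lower_region_def open_lower_region_def per)

text \<open>The origin stands for infinite depth and is inserted by hand; \<open>period_log\<close>
  is consulted only away from it.\<close>

definition fluid_disc :: "complex set" where
  "fluid_disc = insert 0 {q. q \<noteq> 0 \<and> period_log L q \<in> open_lower_region \<eta>}"

definition closed_fluid_disc :: "complex set" where
  "closed_fluid_disc = insert 0 {q. q \<noteq> 0 \<and> period_log L q \<in> lower_region \<eta>}"

text \<open>This is the height of the surface above the point; its sign decides membership in the
  discs. The real part of \<open>period_log\<close> jumps across the cut, but only by periods of
  \<eta>, and its imaginary part is a multiple of \<open>ln (norm q)\<close>.\<close>

lemma continuous_on_profile_log:
  "continuous_on (-{0}) (\<lambda>q. \<eta> (Re (period_log L q)) - Im (period_log L q))"
proof (rule continuous_on_diff)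
  have "continuous_on {q. q \<noteq> 0 \<and> period_log L q \<in> UNIV} (\<lambda>q. \<eta> (Re (period_log L q)))"
    by (rule continuous_on_period_log)
       (auto simp: per intro!: continuous_on_compose2[OF cont] continuous_intros)
  then show "continuous_on (-{0}) (\<lambda>q. \<eta> (Re (period_log L q)))"
    by (simp add: Compl_eq)
  have "continuous_on (-{0}) (\<lambda>q::complex. L / (2 * pi) * ln (norm q))"
    by (intro continuous_intros) auto
  then show "continuous_on (-{0}) (\<lambda>q. Im (period_log L q))"
    by (rule continuous_on_eq) (auto simp: Im_period_log)
qed

lemma filterlim_Im_period_log: "filterlim (\<lambda>q. Im (period_log L q)) at_bot (at 0)"
proof -
  have n: "filterlim (\<lambda>q::complex. norm q) (at_right 0) (at 0)"
    unfolding filterlim_at by (auto simp: eventually_at_filter intro!: tendsto_eq_intros)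
  have "filterlim (\<lambda>q::complex. L / (2 * pi) * ln (norm q)) at_bot (at 0)"
    using L_pos
    by (intro filterlim_tendsto_pos_mult_at_bot[OF tendsto_const]
              filterlim_compose[OF ln_at_0 n]) simp
  then show ?thesis
    by (rule filterlim_mono_eventually) (auto simp: eventually_at_filter Im_period_log)
qed

lemma eventually_period_log_region: "\<forall>\<^sub>F q in at 0. period_log L q \<in> open_lower_region \<eta>"
proof -
  obtain m where m: "\<And>x. m \<le> \<eta> x" using profile_bounds by blast
  have "\<forall>\<^sub>F q in at 0. Im (period_log L q) < m"
    using filterlim_Im_period_log by (simp add: filterlim_at_bot_dense)
  then show ?thesis
    by (rule eventually_mono) (use m in \<open>auto simp: open_lower_region_def intro: less_le_trans\<close>)
qed

text \<open>At the origin openness comes from the lower bound of the profile, elsewhere from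
  continuity of the height gap \<open>?h\<close>.\<close>

lemma open_fluid_disc: "open fluid_disc"
proof -
  let ?h = "\<lambda>q. \<eta> (Re (period_log L q)) - Im (period_log L q)"
  obtain T where T: "open T" "0 \<in> T" "\<And>q. q \<in> T \<Longrightarrow> q \<noteq> 0 \<Longrightarrow> period_log L q \<in> open_lower_region \<eta>"
    using eventually_period_log_region unfolding eventually_at_topological by blast
  have "open (-{0} \<inter> ?h -` {0<..})"
    using continuous_on_profile_log by (rule continuous_open_preimage) auto
  with T(1) have "open (T \<union> (-{0} \<inter> ?h -` {0<..}))" by (rule open_Un)
  moreover have "T \<union> (-{0} \<inter> ?h -` {0<..}) = fluid_disc"
    using T by (auto simp: fluid_disc_def open_lower_region_def)
  ultimately show ?thesis by simp
qed

lemma open_punctured_fluid_disc: "open {q. q \<noteq> 0 \<and> period_log L q \<in> open_lower_region \<eta>}"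
proof -
  have "open (fluid_disc - {0})" using open_fluid_disc by (intro open_Diff) auto
  moreover have "fluid_disc - {0} = {q. q \<noteq> 0 \<and> period_log L q \<in> open_lower_region \<eta>}"
    by (auto simp: fluid_disc_def)
  ultimately show ?thesis by simp
qed

lemma closed_closed_fluid_disc: "closed closed_fluid_disc"
proof -
  let ?h = "\<lambda>q. \<eta> (Re (period_log L q)) - Im (period_log L q)"
  have "open (-{0} \<inter> ?h -` {..<0})"
    using continuous_on_profile_log by (rule continuous_open_preimage) auto
  moreover have "-{0} \<inter> ?h -` {..<0} = - closed_fluid_disc"
    by (auto simp: closed_fluid_disc_def lower_region_def not_le)
  ultimately show ?thesis by (simp add: closed_def)
qed

lemma fluid_disc_subset_closed: "fluid_disc \<subseteq> closed_fluid_disc"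
  using open_lower_region_subset by (auto simp: fluid_disc_def closed_fluid_disc_def)

lemma closure_fluid_disc_subset: "closure fluid_disc \<subseteq> closed_fluid_disc"
  using fluid_disc_subset_closed closed_closed_fluid_disc by (simp add: closure_minimal)

lemma bounded_fluid_disc: "bounded fluid_disc"
proof -
  obtain M where M: "\<And>x. \<eta> x \<le> M" using profile_bounds by blast
  have "norm q \<le> exp (M * (2 * pi) / L)" if "q \<in> fluid_disc" for q
  proof (cases "q = 0")
    case False
    then have "Im (period_log L q) \<le> M"
      using that M by (auto simp: fluid_disc_def open_lower_region_def intro: order_trans less_imp_le)
    then have "ln (norm q) \<le> M * (2 * pi) / L"
      using False L_pos by (simp add: Im_period_log field_simps)
    then have "exp (ln (norm q)) \<le> exp (M * (2 * pi) / L)" by simp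
    then show ?thesis using False by simp
  qed simp
  then show ?thesis by (auto simp: bounded_iff)
qed

text \<open>Shrinking \<open>q\<close> towards the origin keeps the horizontal position and only
  lowers the point, so the region below a graph becomes starlike.\<close>

lemma connected_fluid_disc: "connected fluid_disc"
proof (rule starlike_imp_connected)
  have *: "t *\<^sub>R q \<in> fluid_disc" if q: "q \<in> fluid_disc" and t: "0 \<le> t" "t \<le> 1" for t q
  proof (cases "q = 0 \<or> t = 0")
    case False
    then have t0: "t > 0" and q0: "q \<noteq> 0" using t by auto
    have Ln: "Ln (t *\<^sub>R q) = of_real (ln t) + Ln q"
      using t0 q0 by (simp add: scaleR_conv_of_real Ln_times_of_real Ln_of_real)
    have "Re (period_log L (t *\<^sub>R q)) = Re (period_log L q)"
      by (simp add: Re_period_log Ln)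
    moreover have "Im (period_log L (t *\<^sub>R q)) \<le> Im (period_log L q)"
    proof -
      have "L / (2 * pi) * ln t \<le> 0"
        using L_pos t t0 by (intro mult_nonneg_nonpos) auto
      moreover have "Im (period_log L (t *\<^sub>R q)) = L / (2 * pi) * ln t + Im (period_log L q)"
        using q0 by (simp add: period_log_def Ln distrib_left)
      ultimately show ?thesis by simp
    qed
    ultimately show ?thesis
      using q q0 t0 by (auto simp: fluid_disc_def open_lower_region_def)
  qed (auto simp: fluid_disc_def)
  have "closed_segment 0 q \<subseteq> fluid_disc" if "q \<in> fluid_disc" for q
    using *[OF that] by (auto simp: closed_segment_def)
  moreover have "0 \<in> fluid_disc" by (simp add: fluid_disc_def)
  ultimately show "starlike fluid_disc" unfolding starlike_def by blast
qed

text \<open>Convergence along \<open>filtercomap Im at_bot\<close> is uniform in the horizontal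
  direction and supplies the value at the centre of the disc. The classical maximum modulus
  principle then applies to the descended function \<open>G\<close>.\<close>

proposition periodic_maximum_modulus:
  fixes f :: "complex \<Rightarrow> complex"
  assumes contf: "continuous_on (lower_region \<eta>) f"
    and holf: "f holomorphic_on open_lower_region \<eta>"
    and perf: "\<And>z. z \<in> lower_region \<eta> \<Longrightarrow> f (z + of_real L) = f z"
    and lim: "(f \<longlongrightarrow> l) (filtercomap Im at_bot)"
    and B: "\<And>z. Im z = \<eta> (Re z) \<Longrightarrow> norm (f z) \<le> B"
  shows "z \<in> lower_region \<eta> \<Longrightarrow> norm (f z) \<le> B" and "norm l \<le> B"
    and "z \<in> open_lower_region \<eta> \<Longrightarrow> norm (f z) = B \<Longrightarrow> w \<in> lower_region \<eta> \<Longrightarrow> f w = l"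
proof -
  define G where "G q = (if q = 0 then l else f (period_log L q))" for q
  have perf': "\<And>z. z \<in> open_lower_region \<eta> \<Longrightarrow> f (z + of_real L) = f z"
    using perf open_lower_region_subset by blast
  have "(\<lambda>q. f (period_log L q)) \<midarrow>0\<rightarrow> l"
    using lim by (rule filterlim_compose)
      (simp add: filterlim_filtercomap_iff o_def filterlim_Im_period_log)
  then have "G \<midarrow>0\<rightarrow> l"
    by (rule Lim_transform_eventually) (auto simp: G_def eventually_at_filter)
  then have G0: "G \<midarrow>0\<rightarrow> G 0" by (simp add: G_def)
  have disc0: "fluid_disc - {0} = {q. q \<noteq> 0 \<and> period_log L q \<in> open_lower_region \<eta>}"
    "closed_fluid_disc - {0} = {q. q \<noteq> 0 \<and> period_log L q \<in> lower_region \<eta>}"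
    by (auto simp: fluid_disc_def closed_fluid_disc_def)
  have "(\<lambda>q. f (period_log L q)) holomorphic_on fluid_disc - {0}"
    unfolding disc0 using open_lower_region_shift perf' holf open_open_lower_region[OF cont]
      open_punctured_fluid_disc
    by (rule holomorphic_on_period_log)
  then have "G holomorphic_on fluid_disc - {0}"
    by (rule holomorphic_transform) (auto simp: G_def)
  \<comment> \<open>The puncture is a removable singularity because \<open>G\<close> is continuous
    at the origin.\<close>
  then have holG: "G holomorphic_on fluid_disc"
  proof (rule no_isolated_singularity'[where K = "{0}", rotated])
    show "(G \<longlongrightarrow> G z) (at z within fluid_disc)" if "z \<in> {0}" for z
      using G0 that by (auto intro: tendsto_within_subset)
  qed (use open_fluid_disc in auto)
  have "continuous_on (closed_fluid_disc - {0}) (\<lambda>q. f (period_log L q))"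
    unfolding disc0 using lower_region_shift perf contf by (rule continuous_on_period_log)
  then have cont0: "continuous_on (closed_fluid_disc - {0}) G"
    by (rule continuous_on_eq) (auto simp: G_def)
  have contG: "continuous_on closed_fluid_disc G"
    unfolding continuous_on_eq_continuous_within
  proof
    fix q assume q: "q \<in> closed_fluid_disc"
    show "continuous (at q within closed_fluid_disc) G"
    proof (cases "q = 0")
      case True
      then show ?thesis using G0 by (auto simp: continuous_within intro: tendsto_within_subset)
    next
      case False
      then have "continuous (at q within closed_fluid_disc - {0}) G"
        using q cont0 by (simp add: continuous_on_eq_continuous_within)
      moreover have "at q within closed_fluid_disc - {0} = at q within closed_fluid_disc"
        using False by (intro at_within_nhd[of q "-{0}"]) auto
      ultimately show ?thesis by simp
    qed
  qed
  \<comment> \<open>A frontier point lies in the closed disc but not in the open one, so it comes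
    from a point of the surface.\<close>
  have Bfront: "norm (G q) \<le> B" if q: "q \<in> frontier fluid_disc" for q
  proof -
    have "q \<in> closed_fluid_disc" "q \<notin> fluid_disc"
      using q closure_fluid_disc_subset open_fluid_disc by (auto simp: frontier_def interior_open)
    then have "q \<noteq> 0" "Im (period_log L q) = \<eta> (Re (period_log L q))"
      by (auto simp: fluid_disc_def closed_fluid_disc_def lower_region_def open_lower_region_def)
    then show ?thesis using B by (simp add: G_def)
  qed
  have leB: "norm (G q) \<le> B" if "q \<in> fluid_disc" for q
    using maximum_modulus_frontier[of G fluid_disc B q] holG open_fluid_disc bounded_fluid_disc Bfront that
      continuous_on_subset[OF contG closure_fluid_disc_subset] by (simp add: interior_open)
  \<comment> \<open>Every fluid point has a preimage up to periods, and periods do not change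
    \<open>f\<close>.\<close>
  have lift: "\<exists>q. q \<noteq> 0 \<and> G q = f z \<and> q \<in> fluid_disc" if z: "z \<in> open_lower_region \<eta>" for z
  proof -
    obtain q n where q: "q \<noteq> 0" "period_log L q = z + of_int n * of_real L"
      using period_log_surj[OF L_pos] by blast
    then show ?thesis
      using periodic_on_of_int[of "of_real L" "open_lower_region \<eta>" f z n]
        open_lower_region_shift perf' z by (auto simp: G_def fluid_disc_def)
  qed
  show "norm (f z) \<le> B" if z: "z \<in> lower_region \<eta>"
  proof (cases "Im z = \<eta> (Re z)")
    case False
    with z have "z \<in> open_lower_region \<eta>"
      by (auto simp: lower_region_def open_lower_region_def)
    then show ?thesis using lift leB by metis
  qed (use B in auto)
  show "norm l \<le> B"
    using leB[of 0] by (simp add: G_def fluid_disc_def)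
  assume z: "z \<in> open_lower_region \<eta>" "norm (f z) = B" and w: "w \<in> lower_region \<eta>"
  obtain q where q: "q \<in> fluid_disc" "norm (G q) = B" using lift z by metis
  \<comment> \<open>Attaining the bound inside makes \<open>G\<close> constant; the constant is read
    off at the origin.\<close>
  have "G constant_on fluid_disc"
    using maximum_modulus_principle[OF holG open_fluid_disc connected_fluid_disc open_fluid_disc _ q(1)] leB q(2)
    by simp
  then have const: "G p = l" if "p \<in> fluid_disc" for p
    using that by (auto simp: constant_on_def fluid_disc_def G_def)
  then have "f w' = l" if "w' \<in> open_lower_region \<eta>" for w'
    using lift that by metis
  then show "f w = l"
    using continuous_constant_on_closure[of "open_lower_region \<eta>" f l w] contf w
    by (simp add: closure_open_lower_region[OF cont])
qed

text \<open>The modulus of \<open>exp (f z)\<close> is the exponential of \<open>Re (f z)\<close>,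
  so the modulus principle for \<open>exp (f z)\<close> gives the claim.\<close>

corollary periodic_maximum_Re:
  fixes f :: "complex \<Rightarrow> complex"
  assumes contf: "continuous_on (lower_region \<eta>) f"
    and holf: "f holomorphic_on open_lower_region \<eta>"
    and perf: "\<And>z. z \<in> lower_region \<eta> \<Longrightarrow> f (z + of_real L) = f z"
    and lim: "(f \<longlongrightarrow> l) (filtercomap Im at_bot)"
    and B: "\<And>z. Im z = \<eta> (Re z) \<Longrightarrow> Re (f z) \<le> B"
  shows "z \<in> lower_region \<eta> \<Longrightarrow> Re (f z) \<le> B" and "Re l \<le> B"
    and "z \<in> open_lower_region \<eta> \<Longrightarrow> Re (f z) = B \<Longrightarrow> Re l = B"
proof -
  have 1: "continuous_on (lower_region \<eta>) (\<lambda>z. exp (f z))"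
    using contf by (intro continuous_intros)
  have 2: "(\<lambda>z. exp (f z)) holomorphic_on open_lower_region \<eta>"
    using holf by (intro holomorphic_intros)
  have 3: "((\<lambda>z. exp (f z)) \<longlongrightarrow> exp l) (filtercomap Im at_bot)"
    using lim by (rule tendsto_exp)
  note max = periodic_maximum_modulus[OF 1 2 _ 3, where B = "exp B"]
  show "Re (f z) \<le> B" if "z \<in> lower_region \<eta>"
    using max(1)[of z] that perf B by simp
  show "Re l \<le> B"
    using max(2) perf B by simp
  assume z: "z \<in> open_lower_region \<eta>" "Re (f z) = B"
  then have "exp (f z) = exp l"
    using max(3)[of z z] perf B open_lower_region_subset by auto
  then show "Re l = B" using z by (metis exp_le_cancel_iff norm_exp_eq_Re order_antisym order_refl)
qed

end

section \<open>Extrema of the speed\<close>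

context periodic_profile
begin

text \<open>Periodicity and evenness fold \<open>x\<close> into a point \<open>y\<close> of
  [0, L/2], where monotonicity applies. Points that fold to the relevant endpoint lie in the
  excluded set.\<close>

lemma unimodal_profile_less:
  assumes mono: "monotone_on {0..L/2} (<) (>) \<eta>" and even: "\<And>x. \<eta> (- x) = \<eta> x"
  shows less_crest: "x \<notin> range (\<lambda>n::int. of_int n * L) \<Longrightarrow> \<eta> x < \<eta> 0"
    and trough_less: "x \<notin> range (\<lambda>n::int. L/2 + of_int n * L) \<Longrightarrow> \<eta> (L/2) < \<eta> x"
proof -
  obtain n :: int where n: "- (L / 2) \<le> x + of_int n * L" "x + of_int n * L \<le> L / 2"
    by (rule shift_into_centered_period)
  define y where "y = \<bar>x + of_int n * L\<bar>"
  have y: "0 \<le> y" "y \<le> L / 2" using n unfolding y_def by linarith+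
  have \<eta>: "\<eta> x = \<eta> y"
    using periodic_of_int[of \<eta> L x n, OF per] even[of "x + of_int n * L"] by (auto simp: y_def abs_if)
  show "\<eta> x < \<eta> 0" if "x \<notin> range (\<lambda>n::int. of_int n * L)"
  proof -
    have "y \<noteq> 0"
    proof
      assume "y = 0"
      then have "x = of_int (-n) * L" by (simp add: y_def)
      with that show False by blast
    qed
    then have "\<eta> y < \<eta> 0" using y L_pos by (intro monotone_onD[OF mono]) auto
    with \<eta> show ?thesis by simp
  qed
  show "\<eta> (L/2) < \<eta> x" if "x \<notin> range (\<lambda>n::int. L/2 + of_int n * L)"
  proof -
    have "y \<noteq> L / 2"
    proof
      assume "y = L / 2"
      \<comment> \<open>Resolving the absolute value gives \<open>L / 2\<close> or
        \<open>- (L / 2)\<close>; the latter costs one further period.\<close>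
      then have "x = L / 2 + of_int (-n) * L \<or> x = L / 2 + of_int (-n-1) * L"
        by (auto simp: y_def abs_if algebra_simps split: if_splits)
      with that show False by blast
    qed
    then have "\<eta> (L/2) < \<eta> y" using y L_pos by (intro monotone_onD[OF mono]) auto
    with \<eta> show ?thesis by simp
  qed
qed

text \<open>This interval runs from crest to crest, so that crests occur only at its
  endpoints.\<close>

lemma shift_into_period:
  obtains n :: int where "x + of_int n * L \<in> {0..L}"
proof
  have "of_int \<lfloor>x / L\<rfloor> \<le> x / L" "x / L \<le> of_int \<lfloor>x / L\<rfloor> + 1" by linarith+
  then have "of_int \<lfloor>x / L\<rfloor> * L \<le> x" "x \<le> (of_int \<lfloor>x / L\<rfloor> + 1) * L"
    using L_pos by (simp_all only: pos_le_divide_eq pos_divide_le_eq)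
  then show "x + of_int (- \<lfloor>x / L\<rfloor>) * L \<in> {0..L}"
    by (simp add: algebra_simps)
qed

text \<open>Here \<open>f\<close> abstracts the complex velocity. By \<open>bernoulli\<close> the
  speed on the surface strictly decreases with height; \<open>kinematic\<close> enters through the
  sign of \<open>Re (f z)\<close> on the surface.\<close>

lemma speed_extrema:
  fixes f :: "complex \<Rightarrow> complex" and c g K :: real
  assumes mono: "monotone_on {0..L/2} (<) (>) \<eta>" and even: "\<And>x. \<eta> (- x) = \<eta> x"
    and contf: "continuous_on (lower_region \<eta>) f"
    and holf: "f holomorphic_on open_lower_region \<eta>"
    and perf: "\<And>z. z \<in> lower_region \<eta> \<Longrightarrow> f (z + of_real L) = f z"
    and lim: "(f \<longlongrightarrow> of_real (- c)) (filtercomap Im at_bot)"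
    and pos: "c > 0" "g > 0"
    and bernoulli: "\<And>z. Im z = \<eta> (Re z) \<Longrightarrow> (norm (f z))\<^sup>2 = K - 2 * g * \<eta> (Re z)"
    and kinematic: "\<And>z. Im z = \<eta> (Re z) \<Longrightarrow> Re (f z) = 0 \<Longrightarrow> f z = 0"
    and z: "z \<in> lower_region \<eta>"
  shows crest_speed_less:
      "z \<notin> range (\<lambda>n::int. Complex (of_int n * L) (\<eta> 0)) \<Longrightarrow> norm (f (Complex 0 (\<eta> 0))) < norm (f z)"
    and speed_less_trough:
      "z \<notin> range (\<lambda>n::int. Complex (L/2 + of_int n * L) (\<eta> (L/2))) \<Longrightarrow>
        norm (f z) < norm (f (Complex (L/2) (\<eta> (L/2))))"
proof -
  let ?crest = "Complex 0 (\<eta> 0)" and ?trough = "Complex (L/2) (\<eta> (L/2))"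
  note per_int = periodic_of_int[of \<eta> L, OF per]
  note less_crest = less_crest[OF mono even] and trough_less = trough_less[OF mono even]
  have le_crest: "\<eta> x \<le> \<eta> 0" for x
  proof (cases "x \<in> range (\<lambda>n::int. of_int n * L)")
    case True
    then obtain n :: int where "x = of_int n * L" by blast
    then show ?thesis using per_int[of 0 n] by simp
  next
    case False
    then show ?thesis by (intro less_imp_le less_crest)
  qed
  have trough_le: "\<eta> (L/2) \<le> \<eta> x" for x
  proof (cases "x \<in> range (\<lambda>n::int. L/2 + of_int n * L)")
    case True
    then obtain n :: int where "x = L/2 + of_int n * L" by blast
    then show ?thesis using per_int[of "L/2" n] by simp
  next
    case False
    then show ?thesis by (intro less_imp_le trough_less)
  qed
  have speed_less: "norm (f a) < norm (f b)"
    if "Im a = \<eta> (Re a)" "Im b = \<eta> (Re b)" "\<eta> (Re b) < \<eta> (Re a)" for a b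
  proof (rule power2_less_imp_less)
    show "(norm (f a))\<^sup>2 < (norm (f b))\<^sup>2"
      unfolding bernoulli[OF that(1)] bernoulli[OF that(2)] using that(3) pos(2) by simp
  qed simp
  have speed_le: "norm (f a) \<le> norm (f b)"
    if "Im a = \<eta> (Re a)" "Im b = \<eta> (Re b)" "\<eta> (Re b) \<le> \<eta> (Re a)" for a b
  proof (rule power2_le_imp_le)
    show "(norm (f a))\<^sup>2 \<le> (norm (f b))\<^sup>2"
      unfolding bernoulli[OF that(1)] bernoulli[OF that(2)] using that(3) pos(2) by simp
  qed simp
  have surface_le: "norm (f ?crest) \<le> norm (f w)" "norm (f w) \<le> norm (f ?trough)"
    if "Im w = \<eta> (Re w)" for w
    using that le_crest trough_le by (auto intro!: speed_le)
  have surface_crest: "norm (f ?crest) < norm (f w)"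
    if "Im w = \<eta> (Re w)" "w \<notin> range (\<lambda>n::int. Complex (of_int n * L) (\<eta> 0))" for w
  proof -
    have "Re w \<notin> range (\<lambda>n::int. of_int n * L)"
    proof
      assume "Re w \<in> range (\<lambda>n::int. of_int n * L)"
      then obtain n :: int where "Re w = of_int n * L" by blast
      then have "w = Complex (of_int n * L) (\<eta> 0)"
        using that(1) per_int[of 0 n] by (simp add: complex_eq_iff)
      with that(2) show False by blast
    qed
    then show ?thesis
      using less_crest[of "Re w"] that(1) by (intro speed_less) simp_all
  qed
  have surface_trough: "norm (f w) < norm (f ?trough)"
    if "Im w = \<eta> (Re w)" "w \<notin> range (\<lambda>n::int. Complex (L/2 + of_int n * L) (\<eta> (L/2)))" for w
  proof -
    have "Re w \<notin> range (\<lambda>n::int. L/2 + of_int n * L)"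
    proof
      assume "Re w \<in> range (\<lambda>n::int. L/2 + of_int n * L)"
      then obtain n :: int where "Re w = L/2 + of_int n * L" by blast
      then have "w = Complex (L/2 + of_int n * L) (\<eta> (L/2))"
        using that(1) per_int[of "L/2" n] by (simp add: complex_eq_iff)
      with that(2) show False by blast
    qed
    then show ?thesis
      using trough_less[of "Re w"] that(1) by (intro speed_less) simp_all
  qed
  have not_const: "norm (f ?crest) < norm (f ?trough)"
  proof -
    have "\<eta> (L/2) < \<eta> 0" using L_pos by (intro monotone_onD[OF mono]) auto
    then show ?thesis by (intro speed_less) simp_all
  qed

  define s where "s x = Re (f (Complex x (\<eta> x)))" for x
  have conts: "continuous_on A s" for A
    unfolding s_def
    by (intro continuous_intros continuous_on_compose2[OF contf] continuous_on_subset[OF cont])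
       (auto simp: lower_region_def)
  \<comment> \<open>Between two crests the speed strictly exceeds the speed at the crest, hence is
    positive, while \<open>s x = 0\<close> would make the point stagnant.\<close>
  have s_nz: "s x \<noteq> 0" if "x \<in> {0<..<L}" for x
  proof
    assume "s x = 0"
    then have 0: "f (Complex x (\<eta> x)) = 0" using kinematic[of "Complex x (\<eta> x)"] by (simp add: s_def)
    have "Complex x (\<eta> x) \<noteq> Complex (of_int n * L) (\<eta> 0)" for n :: int
    proof
      assume "Complex x (\<eta> x) = Complex (of_int n * L) (\<eta> 0)"
      then have "0 < of_int n * L" "of_int n * L < 1 * L" using that by auto
      then have "0 < real_of_int n" "real_of_int n < 1"
        using L_pos by (simp_all add: zero_less_mult_iff)
      then show False by simp
    qed
    then have "Complex x (\<eta> x) \<notin> range (\<lambda>n::int. Complex (of_int n * L) (\<eta> 0))" by blast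
    then show False
      using surface_crest[of "Complex x (\<eta> x)"] 0 by simp
  qed
  have conn: "connected (s ` {0<..<L})"
    using conts by (intro connected_continuous_image) auto
  \<comment> \<open>By the intermediate value property a change of sign would produce a
    zero.\<close>
  have "\<not> (s a < 0 \<and> 0 < s b)" if "a \<in> {0<..<L}" "b \<in> {0<..<L}" for a b
  proof
    assume "s a < 0 \<and> 0 < s b"
    then have "0 \<in> {s a..s b}" by simp
    then have "0 \<in> s ` {0<..<L}" using connected_contains_Icc[OF conn] that by blast
    then show False using s_nz by fastforce
  qed
  then have "(\<forall>x\<in>{0<..<L}. s x \<ge> 0) \<or> (\<forall>x\<in>{0<..<L}. s x \<le> 0)"
    by (meson not_le)
  moreover have "closure {0<..<L} = {0..L}" using L_pos by simp
  \<comment> \<open>Closing the interval adds the two crests, where \<open>s\<close> may vanish;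
    hence the weak inequalities.\<close>
  ultimately have sign: "(\<forall>x\<in>{0..L}. s x \<ge> 0) \<or> (\<forall>x\<in>{0..L}. s x \<le> 0)"
    by (metis conts continuous_ge_on_closure continuous_le_on_closure)
  have s_per: "s (x + of_int n * L) = s x" for x n
  proof (rule periodic_of_int)
    show "s (x + L) = s x" for x
    proof -
      have "Complex (x + L) (\<eta> x) = Complex x (\<eta> x) + of_real L" by (simp add: complex_eq_iff)
      then show ?thesis
        using perf[of "Complex x (\<eta> x)"] per[of x] by (simp add: s_def lower_region_def)
    qed
  qed
  have ext: "\<exists>y\<in>{0..L}. s x = s y" for x
  proof -
    obtain n :: int where "x + of_int n * L \<in> {0..L}" by (rule shift_into_period)
    then show ?thesis using s_per[of x n] by metis
  qed
  \<comment> \<open>A nonnegative sign is refuted at infinite depth: the bound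
    \<open>Re (- f w)\<close> \<le> 0 on the surface would pass to the limit \<open>c\<close>, which
    is positive.\<close>
  have "\<not> (\<forall>x\<in>{0..L}. s x \<ge> 0)"
  proof
    assume "\<forall>x\<in>{0..L}. s x \<ge> 0"
    then have *: "s x \<ge> 0" for x using ext[of x] by auto
    have "Re (- of_real (- c)) \<le> (0::real)"
    proof (rule periodic_maximum_Re(2))
      show "continuous_on (lower_region \<eta>) (\<lambda>z. - f z)"
        using contf by (rule continuous_on_minus)
      show "(\<lambda>z. - f z) holomorphic_on open_lower_region \<eta>"
        using holf by (rule holomorphic_on_minus)
      show "((\<lambda>z. - f z) \<longlongrightarrow> - of_real (- c)) (filtercomap Im at_bot)"
        using lim by (rule tendsto_minus)
      show "Re (- f w) \<le> 0" if "Im w = \<eta> (Re w)" for w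
        using *[of "Re w"] by (simp add: s_def flip: that)
    qed (simp add: perf)
    then show False using pos by simp
  qed
  with sign have s_le: "s x \<le> 0" for x using ext[of x] by auto
  have Re_le: "Re (f w) \<le> 0" if "Im w = \<eta> (Re w)" for w
    using s_le[of "Re w"] by (simp add: s_def flip: that)
  \<comment> \<open>A zero inside would attain the bound 0 of the real part and force the limit
    \<open>- c\<close> to be 0.\<close>
  have nz: "f w \<noteq> 0" if w: "w \<in> open_lower_region \<eta>" for w
    using periodic_maximum_Re(3)[OF contf holf perf lim Re_le w] pos by auto

  show "norm (f z) < norm (f ?trough)"
    if "z \<notin> range (\<lambda>n::int. Complex (L/2 + of_int n * L) (\<eta> (L/2)))"
  proof (cases "Im z = \<eta> (Re z)")
    case False
    then have zi: "z \<in> open_lower_region \<eta>"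
      using z by (auto simp: lower_region_def open_lower_region_def)
    note max = periodic_maximum_modulus[OF contf holf perf lim surface_le(2)]
    \<comment> \<open>Equality would make \<open>f\<close> constant, contradicting the different
      speeds at crest and trough.\<close>
    have "norm (f z) \<noteq> norm (f ?trough)"
      using max(3)[OF _ _ zi, of ?crest] max(3)[OF _ _ zi, of ?trough] not_const
      by (auto simp: lower_region_def)
    then show ?thesis using max(1)[OF _ _ z] by simp
  qed (use surface_trough that in auto)

  show "norm (f ?crest) < norm (f z)"
    if "z \<notin> range (\<lambda>n::int. Complex (of_int n * L) (\<eta> 0))"
  proof (cases "Im z = \<eta> (Re z)")
    case False
    then have zi: "z \<in> open_lower_region \<eta>"
      using z by (auto simp: lower_region_def open_lower_region_def)
    show ?thesis
    \<comment> \<open>A stagnant crest is slower than every interior point, since zeros are excluded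
      there. Otherwise \<open>f\<close> has no zeros at all, and the maximum principle applies to
      its reciprocal.\<close>
    proof (cases "f ?crest = 0")
      case True
      then show ?thesis using nz[OF zi] by simp
    next
      case crest_nz: False
      have nz': "f w \<noteq> 0" if "w \<in> lower_region \<eta>" for w
        using that nz[of w] surface_le(1)[of w] crest_nz
        by (force simp: lower_region_def open_lower_region_def)
      have 1: "continuous_on (lower_region \<eta>) (\<lambda>z. inverse (f z))"
        using contf nz' by (intro continuous_intros) auto
      have 2: "(\<lambda>z. inverse (f z)) holomorphic_on open_lower_region \<eta>"
        using holf nz by (intro holomorphic_intros) auto
      have 3: "((\<lambda>z. inverse (f z)) \<longlongrightarrow> inverse (of_real (- c))) (filtercomap Im at_bot)"
        using lim pos by (intro tendsto_inverse) auto
      have 4: "norm (inverse (f w)) \<le> norm (inverse (f ?crest))" if "Im w = \<eta> (Re w)" for w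
        using surface_le(1)[OF that] crest_nz by (simp add: norm_inverse le_imp_inverse_le)
      note max = periodic_maximum_modulus[OF 1 2 _ 3 4]
      have "norm (inverse (f z)) \<noteq> norm (inverse (f ?crest))"
        using max(3)[OF _ _ zi, of ?crest] max(3)[OF _ _ zi, of ?trough] not_const perf
        by (auto simp: lower_region_def)
      moreover have "norm (inverse (f z)) \<le> norm (inverse (f ?crest))"
        using max(1)[OF _ _ z] perf by simp
      ultimately have "inverse (norm (f z)) < inverse (norm (f ?crest))"
        unfolding norm_inverse by linarith
      then show ?thesis by (rule inverse_less_imp_less) (use nz[OF zi] in auto)
    qed
  qed (use surface_crest that in auto)
qed

end

section \<open>Bernoulli's law and the complex velocity\<close>

text \<open>The chosen \<open>frechet_derivative\<close> is linear, so its values on the two basis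
  vectors determine it, at surface points as well.\<close>

lemma has_derivative_partials:
  assumes "f differentiable (at z within D)"
  shows "(f has_derivative (\<lambda>h. fst h * partial_x D f z + snd h * partial_y D f z)) (at z within D)"
proof -
  let ?F = "frechet_derivative f (at z within D)"
  have F: "(f has_derivative ?F) (at z within D)"
    using assms by (simp add: frechet_derivative_works)
  then interpret linear ?F by (rule has_derivative_linear)
  have "?F = (\<lambda>h. fst h * partial_x D f z + snd h * partial_y D f z)"
  proof
    fix h :: "real \<times> real"
    have "h = fst h *\<^sub>R (1, 0) + snd h *\<^sub>R (0, 1)" by (simp add: prod_eq_iff)
    then have "?F h = ?F (fst h *\<^sub>R (1, 0) + snd h *\<^sub>R (0, 1))" by (rule arg_cong)
    then show "?F h = fst h * partial_x D f z + snd h * partial_y D f z"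
      by (simp only: add scaleR) (simp add: partial_x_def partial_y_def)
  qed
  with F show ?thesis by simp
qed

text \<open>The fluid domain need not be convex, so two convex pieces are joined: a vertical ray,
  followed down to height \<open>min y m\<close>, and the half-plane up to height \<open>m\<close>,
  which lies entirely in the fluid.\<close>

lemma zero_derivative_fluid_domain:
  fixes F :: "real \<times> real \<Rightarrow> real"
  assumes F: "\<And>z. z \<in> fluid_domain \<eta> \<Longrightarrow> (F has_derivative (\<lambda>h. 0)) (at z within fluid_domain \<eta>)"
    and m: "\<And>x. m \<le> \<eta> x" and z: "z \<in> fluid_domain \<eta>"
  shows "F z = F (0, m)"
proof -
  let ?D = "fluid_domain \<eta>"
  obtain x y where xy: "z = (x, y)" "y \<le> \<eta> x" using z by (auto simp: fluid_domain_def)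
  have const: "F a = F b" if "convex S" "S \<subseteq> ?D" "a \<in> S" "b \<in> S" for S a b
    using that F by (intro has_derivative_zero_unique[of S F]) (auto intro: has_derivative_subset)
  have "F (x, y) = F (x, min y m)"
    using xy m by (intro const[of "{x} \<times> {..\<eta> x}"] convex_Times) (auto simp: fluid_domain_def)
  also have "\<dots> = F (0, m)"
    using m by (intro const[of "UNIV \<times> {..m}"] convex_Times) (auto simp: fluid_domain_def intro: order_trans)
  finally show ?thesis using xy by simp
qed

lemma bernoulli_law:
  fixes \<eta> :: "real \<Rightarrow> real" and u v P :: "real \<times> real \<Rightarrow> real"
  defines "D \<equiv> fluid_domain \<eta>"
  assumes diff: "u differentiable_on D" "v differentiable_on D" "P differentiable_on D"
    and m: "\<And>x. m \<le> \<eta> x"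
    and euler_x: "\<And>z. z \<in> D \<Longrightarrow> (u z - c) * partial_x D u z + v z * partial_y D u z = - (1 / \<rho>) * partial_x D P z"
    and euler_y: "\<And>z. z \<in> D \<Longrightarrow> (u z - c) * partial_x D v z + v z * partial_y D v z = - (1 / \<rho>) * partial_y D P z - g"
    and irrot: "\<And>z. z \<in> D \<Longrightarrow> partial_y D u z = partial_x D v z"
  obtains K where "\<And>z. z \<in> D \<Longrightarrow> P z / \<rho> + ((u z - c)\<^sup>2 + (v z)\<^sup>2) / 2 + g * snd z = K"
proof -
  define F where "F z = (1 / \<rho>) * P z + (1 / 2) * ((u z - c) * (u z - c) + v z * v z) + g * snd z" for z
  have "(F has_derivative (\<lambda>h. 0)) (at z within D)" if z: "z \<in> D" for z
  proof -
    note d = has_derivative_partials[of _ z D]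
    have [derivative_intros]:
      "(u has_derivative (\<lambda>h. fst h * partial_x D u z + snd h * partial_y D u z)) (at z within D)"
      "(v has_derivative (\<lambda>h. fst h * partial_x D v z + snd h * partial_y D v z)) (at z within D)"
      "(P has_derivative (\<lambda>h. fst h * partial_x D P z + snd h * partial_y D P z)) (at z within D)"
      using diff z by (auto intro!: d simp: differentiable_on_def)
    \<comment> \<open>Irrotationality exchanges \<open>partial_y D u z\<close> and
      \<open>partial_x D v z\<close>, so that the convective terms become the gradient of half the
      squared speed.\<close>
    have x: "(1 / \<rho>) * partial_x D P z = - ((u z - c) * partial_x D u z + v z * partial_x D v z)"
      and y: "(1 / \<rho>) * partial_y D P z = - ((u z - c) * partial_y D u z + v z * partial_y D v z) - g"
      using euler_x[OF z] euler_y[OF z] unfolding irrot[OF z] by linarith+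
    have "(F has_derivative (\<lambda>h.
        fst h * ((1 / \<rho>) * partial_x D P z + ((u z - c) * partial_x D u z + v z * partial_x D v z))
      + snd h * ((1 / \<rho>) * partial_y D P z + ((u z - c) * partial_y D u z + v z * partial_y D v z) + g)))
      (at z within D)"
      unfolding F_def by (rule derivative_eq_intros refl)+ (simp add: fun_eq_iff algebra_simps)
    then show ?thesis unfolding x y by simp
  qed
  then have "F z = F (0, m)" if "z \<in> D" for z
    using zero_derivative_fluid_domain[of \<eta> F m z] m that by (simp add: D_def)
  then show ?thesis using that by (simp add: F_def power2_eq_square)
qed

text \<open>The Cauchy-Riemann equations for u - c - i v are incompressibility and
  irrotationality.\<close>

lemma holomorphic_complex_velocity:
  fixes \<eta> :: "real \<Rightarrow> real" and u v :: "real \<times> real \<Rightarrow> real"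
  defines "D \<equiv> fluid_domain \<eta>"
  assumes cont: "continuous_on UNIV \<eta>"
    and diff: "u differentiable_on D" "v differentiable_on D"
    and incompressible: "\<And>z. z \<in> D \<Longrightarrow> partial_x D u z + partial_y D v z = 0"
    and irrot: "\<And>z. z \<in> D \<Longrightarrow> partial_y D u z = partial_x D v z"
  shows "(\<lambda>z. Complex (u (Re z, Im z) - c) (- v (Re z, Im z))) holomorphic_on open_lower_region \<eta>"
  unfolding holomorphic_on_open[OF open_open_lower_region[OF cont]]
proof
  fix z assume z: "z \<in> open_lower_region \<eta>"
  let ?p = "(Re z, Im z)"
  have p: "?p \<in> {p. snd p < \<eta> (fst p)}" using z by (simp add: open_lower_region_def)
  have "open {p :: real \<times> real. snd p < \<eta> (fst p)}"
    by (intro open_Collect_less continuous_intros continuous_on_compose2[OF cont]) auto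
  \<comment> \<open>Interior points have a full neighbourhood in the fluid, so derivatives within
    \<open>D\<close> are ordinary ones.\<close>
  then have at: "at ?p within D = at ?p"
    using p by (intro at_within_open_subset[where S = "{p. snd p < \<eta> (fst p)}"])
      (auto simp: D_def fluid_domain_def)
  have pD: "?p \<in> D" using p by (simp add: D_def fluid_domain_def)
  have lift: "((\<lambda>z. f (Re z, Im z)) has_derivative
      (\<lambda>h. Re h * partial_x D f ?p + Im h * partial_y D f ?p)) (at z)"
    if "f differentiable_on D" for f :: "real \<times> real \<Rightarrow> real"
  proof -
    have "f differentiable (at ?p within D)" using that pD by (simp add: differentiable_on_def)
    note 1 = has_derivative_partials[OF this, unfolded at]
    have 2: "((\<lambda>z. (Re z, Im z)) has_derivative (\<lambda>h. (Re h, Im h))) (at z)"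
      by (intro derivative_intros)
    show ?thesis
      using diff_chain_at[OF 2 1] by (simp add: o_def)
  qed
  have "((\<lambda>z. complex_of_real (u (Re z, Im z) - c) + \<i> * of_real (- v (Re z, Im z))) has_derivative
     (\<lambda>h. of_real (Re h * partial_x D u ?p + Im h * partial_y D u ?p)
        + \<i> * of_real (- (Re h * partial_x D v ?p + Im h * partial_y D v ?p)))) (at z)"
    using has_derivative_diff[OF lift[OF diff(1)] has_derivative_const[of c]] lift[OF diff(2)]
    by (intro has_derivative_add has_derivative_of_real has_derivative_mult_right has_derivative_minus) simp_all
  \<comment> \<open>The real Jacobian is multiplication by the complex number u_x - i v_x.\<close>
  also have "(\<lambda>h. of_real (Re h * partial_x D u ?p + Im h * partial_y D u ?p)
        + \<i> * of_real (- (Re h * partial_x D v ?p + Im h * partial_y D v ?p))) =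
      (*) (Complex (partial_x D u ?p) (- partial_x D v ?p))"
  proof -
    have "partial_y D v ?p = - partial_x D u ?p" using incompressible[OF pD] by simp
    then show ?thesis
      by (simp add: fun_eq_iff complex_eq_iff irrot[OF pD] algebra_simps)
  qed
  finally show "\<exists>f'. ((\<lambda>z. Complex (u (Re z, Im z) - c) (- v (Re z, Im z))) has_field_derivative f') (at z)"
    unfolding has_field_derivative_def Complex_eq by blast
qed

section \<open>From the speed to the dynamic pressure\<close>

theorem theorem3p2:
  fixes c L \<rho> g Patm :: real
    and \<eta> :: "real \<Rightarrow> real"
    and u v P :: "real \<times> real \<Rightarrow> real"
  defines "D \<equiv> fluid_domain \<eta>"
    and "p \<equiv> dynamic_pressure \<rho> g Patm P"
  assumes "c > 0" and "L > 0" and "\<rho> > 0" and "g > 0"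
    and "regular_wave_train c L \<rho> g Patm \<eta> u v P"
    and "without_current L \<eta> u"
  shows "{z \<in> D. \<forall>w\<in>D. p w \<le> p z} = range (\<lambda>n::int. (of_int n * L, \<eta> 0))
       \<and> {z \<in> D. \<forall>w\<in>D. p z \<le> p w} = range (\<lambda>n::int. (L/2 + of_int n * L, \<eta> (L/2)))"
proof -
  note wave = assms(7)[unfolded regular_wave_train_def Let_def, folded D_def]
  have "water_wave c L \<rho> g Patm \<eta> u v P" using wave by blast
  note ww = this[unfolded water_wave_def Let_def, folded D_def]
  have euler: "\<And>z. z \<in> D \<Longrightarrow> (u z - c) * partial_x D u z + v z * partial_y D u z = - (1 / \<rho>) * partial_x D P z"
      "\<And>z. z \<in> D \<Longrightarrow> (u z - c) * partial_x D v z + v z * partial_y D v z = - (1 / \<rho>) * partial_y D P z - g"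
    and incompressible: "\<And>z. z \<in> D \<Longrightarrow> partial_x D u z + partial_y D v z = 0"
    and irrot: "\<And>z. z \<in> D \<Longrightarrow> partial_y D u z = partial_x D v z"
    and surface: "\<And>x. v (x, \<eta> x) = (u (x, \<eta> x) - c) * deriv \<eta> x" "\<And>x. P (x, \<eta> x) = Patm"
    and decay: "uniform_limit UNIV (\<lambda>y x. (u (x, y), v (x, y))) (\<lambda>x. (0, 0)) at_bot"
    and periodic: "\<And>x. \<eta> (x + L) = \<eta> x" "x_periodic L D u" "x_periodic L D v"
    using ww by blast+
  \<comment> \<open>\<open>(deriv ^^ 0) \<eta>\<close> is the profile itself, and order 1 of
    \<open>Ck_on\<close> gives differentiability up to the surface.\<close>
  have "(deriv ^^ 0) \<eta> differentiable_on UNIV" "Ck_on 1 D u" "Ck_on 1 D v" "Ck_on 1 D P"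
    using wave unfolding smooth_profile_def smooth_on_def by blast+
  then have diff: "u differentiable_on D" "v differentiable_on D" "P differentiable_on D"
    and cont: "continuous_on UNIV \<eta>"
    by (auto intro: differentiable_imp_continuous_on)
  interpret periodic_profile L \<eta>
    using \<open>L > 0\<close> cont periodic(1) by (rule periodic_profile.intro)
  have mono: "monotone_on {0..L/2} (<) (>) \<eta>" and even: "\<And>x. \<eta> (- x) = \<eta> x"
    using wave by auto
  obtain m where m: "\<And>x. m \<le> \<eta> x" using profile_bounds by blast
  obtain K where K: "\<And>z. z \<in> D \<Longrightarrow> P z / \<rho> + ((u z - c)\<^sup>2 + (v z)\<^sup>2) / 2 + g * snd z = K"
    using bernoulli_law[OF diff[unfolded D_def] m, folded D_def, OF euler irrot] by blast

  define f where "f z = Complex (u (Re z, Im z) - c) (- v (Re z, Im z))" for z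
  have inD: "(x, y) \<in> D \<longleftrightarrow> Complex x y \<in> lower_region \<eta>" for x y
    by (simp add: D_def fluid_domain_def lower_region_def)
  \<comment> \<open>This is Bernoulli's law times \<rho>: its gravity term is the one in the dynamic
    pressure, so only the speed and constants remain.\<close>
  have p_eq: "p (x, y) = \<rho> * K - Patm - \<rho> / 2 * (norm (f (Complex x y)))\<^sup>2" if "(x, y) \<in> D" for x y
    using K[OF that] \<open>\<rho> > 0\<close>
    by (simp add: p_def dynamic_pressure_def f_def cmod_power2 field_simps)
  have bernoulli: "(norm (f z))\<^sup>2 = 2 * (K - Patm / \<rho>) - 2 * g * \<eta> (Re z)" if "Im z = \<eta> (Re z)" for z
  proof -
    have "(Re z, Im z) \<in> D" using that by (simp add: inD lower_region_def)
    moreover have "P (Re z, Im z) = Patm" using surface(2) that by simp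
    ultimately show ?thesis
      using K[of "(Re z, Im z)"] that by (simp add: f_def cmod_power2 field_simps)
  qed
  have kinematic: "f z = 0" if "Im z = \<eta> (Re z)" "Re (f z) = 0" for z
  proof -
    have "v (Re z, Im z) = (u (Re z, Im z) - c) * deriv \<eta> (Re z)" using surface(1) that(1) by simp
    then show ?thesis using that(2) by (simp add: f_def complex_eq_iff)
  qed
  have contf: "continuous_on (lower_region \<eta>) f"
  proof -
    have "continuous_on (lower_region \<eta>) (\<lambda>z. h (Re z, Im z))" if "h differentiable_on D" for h :: "real \<times> real \<Rightarrow> real"
      by (intro continuous_on_compose2[OF differentiable_imp_continuous_on[OF that]] continuous_intros)
        (auto simp: inD)
    then show ?thesis
      unfolding f_def using diff(1,2) by (intro continuous_intros) auto
  qed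
  have holf: "f holomorphic_on open_lower_region \<eta>"
    unfolding f_def
    using holomorphic_complex_velocity[OF cont diff(1,2)[unfolded D_def], folded D_def,
        OF incompressible irrot] .
  have perf: "f (z + of_real L) = f z" if "z \<in> lower_region \<eta>" for z
  proof -
    have "(Re z, Im z) \<in> D" using that by (simp add: inD)
    then show ?thesis using periodic(2,3) by (auto simp: f_def x_periodic_def)
  qed
  \<comment> \<open>Uniformity of the decay in \<open>x\<close> is what convergence along
    \<open>filtercomap Im at_bot\<close> requires.\<close>
  have lim: "(f \<longlongrightarrow> of_real (- c)) (filtercomap Im at_bot)"
  proof (rule tendstoI)
    fix e :: real assume "e > 0"
    then have "\<forall>\<^sub>F y in at_bot. \<forall>x. dist (u (x, y), v (x, y)) (0, 0) < e"
      using decay unfolding uniform_limit_iff by auto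
    then have "\<forall>\<^sub>F z in filtercomap Im at_bot. \<forall>x. dist (u (x, Im z), v (x, Im z)) (0, 0) < e"
      by (auto simp: eventually_filtercomap)
    then show "\<forall>\<^sub>F z in filtercomap Im at_bot. dist (f z) (of_real (- c)) < e"
    proof (rule eventually_mono)
      fix z assume "\<forall>x. dist (u (x, Im z), v (x, Im z)) (0, 0) < e"
      then have "dist (u (Re z, Im z), v (Re z, Im z)) (0, 0) < e" by blast
      then show "dist (f z) (of_real (- c)) < e"
        by (simp add: f_def dist_norm norm_Pair cmod_def)
    qed
  qed
  note extrema = speed_extrema[OF mono even contf holf perf lim \<open>c > 0\<close> \<open>g > 0\<close> bernoulli kinematic]
  have p_less: "p (x, y) < p (x', y')"
    if "(x, y) \<in> D" "(x', y') \<in> D" "norm (f (Complex x' y')) < norm (f (Complex x y))" for x y x' y'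
  proof -
    have "(norm (f (Complex x' y')))\<^sup>2 < (norm (f (Complex x y)))\<^sup>2"
      using that(3) by (intro power_strict_mono) auto
    then show ?thesis using p_eq that(1,2) \<open>\<rho> > 0\<close> by simp
  qed
  \<comment> \<open>By \<open>p_eq\<close> the dynamic pressure inherits its period from
    \<open>f\<close>.\<close>
  have p_per: "p (x + of_int n * L, y) = p (x, y)" "(x + of_int n * L, y) \<in> D" if "(x, y) \<in> D" for x y n
  proof -
    have "Complex x y \<in> lower_region \<eta>" using that by (simp add: inD)
    note * = periodic_on_of_int[of "of_real L" "lower_region \<eta>" f, OF lower_region_shift perf this, of n]
    have shift: "Complex (x + of_int n * L) y = Complex x y + of_int n * of_real L"
      by (simp add: complex_eq_iff)
    show D: "(x + of_int n * L, y) \<in> D" using * unfolding inD shift by blast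
    show "p (x + of_int n * L, y) = p (x, y)"
      unfolding p_eq[OF D] p_eq[OF that] shift using * by simp
  qed
  have 0: "(0, \<eta> 0) \<in> D" and L2: "(L/2, \<eta> (L/2)) \<in> D" by (auto simp: inD lower_region_def)
  let ?crests = "range (\<lambda>n::int. (of_int n * L, \<eta> 0))"
  let ?troughs = "range (\<lambda>n::int. (L/2 + of_int n * L, \<eta> (L/2)))"
  have crest: "p q < p (0, \<eta> 0)" if "q \<in> D" "q \<notin> ?crests" for q
  proof -
    obtain x y where q: "q = (x, y)" by (cases q)
    have "Complex x y \<notin> range (\<lambda>n::int. Complex (of_int n * L) (\<eta> 0))"
      using that(2) unfolding q by fastforce
    with that(1) show ?thesis
      unfolding q by (intro p_less 0 extrema(1)) (simp_all add: inD)
  qed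
  have trough: "p (L/2, \<eta> (L/2)) < p q" if "q \<in> D" "q \<notin> ?troughs" for q
  proof -
    obtain x y where q: "q = (x, y)" by (cases q)
    have "Complex x y \<notin> range (\<lambda>n::int. Complex (L/2 + of_int n * L) (\<eta> (L/2)))"
      using that(2) unfolding q by fastforce
    with that(1) show ?thesis
      unfolding q by (intro p_less L2 extrema(2)) (simp_all add: inD)
  qed
  have crests: "q \<in> D \<and> p q = p (0, \<eta> 0)" if q: "q \<in> ?crests" for q
  proof -
    obtain n :: int where "q = (of_int n * L, \<eta> 0)" using q by blast
    then show ?thesis using p_per[OF 0, of n] by simp
  qed
  have troughs: "q \<in> D \<and> p q = p (L/2, \<eta> (L/2))" if q: "q \<in> ?troughs" for q
  proof -
    obtain n :: int where "q = (L/2 + of_int n * L, \<eta> (L/2))" using q by blast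
    then show ?thesis using p_per[OF L2, of n] by simp
  qed
  have le_crest: "p q \<le> p (0, \<eta> 0)" if "q \<in> D" for q
    using crest[OF that] crests[of q] by (cases "q \<in> ?crests") auto
  have trough_le: "p (L/2, \<eta> (L/2)) \<le> p q" if "q \<in> D" for q
    using trough[OF that] troughs[of q] by (cases "q \<in> ?troughs") auto
  \<comment> \<open>The strict inequalities exclude all other points, and periodicity gives the
    extremal value at each listed point.\<close>
  have "q \<in> D \<and> (\<forall>w\<in>D. p w \<le> p q) \<longleftrightarrow> q \<in> ?crests" for q
    using crest crests[of q] le_crest 0 by (metis not_le)
  moreover have "q \<in> D \<and> (\<forall>w\<in>D. p q \<le> p w) \<longleftrightarrow> q \<in> ?troughs" for q
    using trough troughs[of q] trough_le L2 by (metis not_le)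
  ultimately show ?thesis by (simp only: set_eq_iff mem_Collect_eq simp_thms)
qed

end
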